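(* Let $\delta\in\{0,\frac12\}$. For all $\lambda\in\mathbb{C}^*$ and $a,b\in\mathbb{C}$, the spaces $\Omega_{\mathcal{S}(\delta)}(\lambda,a,b)$, $\Omega'_{\mathcal{S}(\delta)}(\lambda,a,b)$, $\Omega''_{\mathcal{S}(\delta)}(\lambda,b)$ and $\tilde\Omega''_{\mathcal{S}(\delta)}(\lambda,b)$, with the actions specified in the context, are $\mathcal{S}(\delta)$-modules.
   Context: All vector spaces and algebras are over $\mathbb{C}$; $\mathbb{C}^*$ is the set of nonzero complex numbers. Modules over Lie superalgebras are $\mathbb{Z}_2$-graded. The Fermion-Virasoro algebra $\mathcal{S}(\delta)$ is the Lie superalgebra with basis $\{L_m,\psi_n,c,z:m\in\mathbb{Z},n\in\mathbb{Z}+\delta\}$, $L_m,c,z$ even, $\psi_n$ odd, with $$[L_m,L_n]=(m-n)L_{m+n}+\delta_{m,-n}\tfrac{m^3-m}{12}c,\quad [L_m,\psi_n]=(-n-\tfrac m2)\psi_{m+n},\quad [\psi_m,\psi_n]=\delta_{m,-n}z$$ (with $\delta_{m,-n}$ the Kronecker symbol) and $c,z$ central. For $\lambda\in\mathbb{C}^*$ fix $\sqrt\lambda\in\mathbb{C}^*$ with $(\sqrt\lambda)^2=\lambda$ and set $\lambda^r=\lambda^{r-\frac12}\sqrt\lambda$ for $r\in\frac12+\mathbb{Z}$. Define the following spaces and actions, with $m\in\mathbb{Z}$, $r\in\delta+\mathbb{Z}$, and $f,g$ arbitrary polynomials in the indicated variable; in all of them $c$ and $z$ act as $0$ and $\psi_r$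 acts as $0$ on the odd part. (i) $\Omega_{\mathcal{S}(\delta)}(\lambda,a,b)=\mathbb{C}[x_0]\oplus\mathbb{C}[x_1]$ with even part $\mathbb{C}[x_0]$ and odd part $\mathbb{C}[x_1]$: $L_m\cdot f(x_0)=\lambda^m(x_0+ma)f(x_0+m)$, $L_m\cdot g(x_1)=\lambda^m(x_1-\frac m2+ma)g(x_1+m)$, $\psi_r\cdot f(x_0)=b\lambda^rf(x_1+r)$. (ii) $\Omega'_{\mathcal{S}(\delta)}(\lambda,a,b)=\mathbb{C}[y_0]\oplus\mathbb{C}[y_1]$ with even part $\mathbb{C}[y_0]$ and odd part $\mathbb{C}[y_1]$: $L_m\cdot f(y_0)=\lambda^m(y_0+ma)f(y_0+m)$, $L_m\cdot g(y_1)=\lambda^m(y_1-\frac{3m}2+ma)g(y_1+m)$, $\psi_r\cdot f(y_0)=b\lambda^r(y_1-2ra+3r)f(y_1+r)$. (iii) $\Omega''_{\mathcal{S}(\delta)}(\lambda,b)=\mathbb{C}[z_0]\oplus\mathbb{C}[z_1]$ with even part $\mathbb{C}[z_0]$ and odd part $\mathbb{C}[z_1]$: $L_m\cdot f(z_0)=\lambda^m(z_0+m)f(z_0+m)$, $L_m\cdot g(z_1)=\lambda^m(z_1-\frac32m)g(z_1+m)$, $\psi_r\cdot f(z_0)=b\lambda^r(z_1+3r)(z_1+r)f(z_1+r)$. (iv) $\tilde\Omega''_{\mathcal{S}(\delta)}(\lambda,b)=\mathbb{C}[\tilde z_0]\oplus\mathbb{C}[\tilde z_1]$ with even part $\mathbb{C}[\tilde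 z_0]$ and odd part $\mathbb{C}[\tilde z_1]$: $L_m\cdot f(\tilde z_0)=\lambda^m(\tilde z_0+\frac52m)f(\tilde z_0+m)$, $L_m\cdot g(\tilde z_1)=\lambda^m\tilde z_1g(\tilde z_1+m)$, $\psi_r\cdot f(\tilde z_0)=b\lambda^r\tilde z_1(\tilde z_1-2r)f(\tilde z_1+r)$. *)

theory Defs
  imports
    Complex_Main
    "HOL-Library.Z2"
    "HOL-Library.Product_Plus"
    "HOL-Library.Poly_Mapping"
    "HOL-Computational_Algebra.Polynomial"
begin

section \<open>Lie superalgebras and their graded modules\<close>

locale super_vector_space = vector_space scale
  for scale :: "complex \<Rightarrow> 'v::ab_group_add \<Rightarrow> 'v" +
  fixes part :: "bit \<Rightarrow> 'v set"
  assumes subspace_part: "subspace (part i)"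
    and part_Int: "part 0 \<inter> part 1 = {0}"
    and part_span: "\<exists>x\<in>part 0. \<exists>y\<in>part 1. v = x + y"

definition super_sign :: "bit \<Rightarrow> bit \<Rightarrow> complex"
  where "super_sign i j = (if i = 1 \<and> j = 1 then -1 else 1)"

locale lie_superalgebra = super_vector_space scale part
  for scale :: "complex \<Rightarrow> 'g::ab_group_add \<Rightarrow> 'g" and part :: "bit \<Rightarrow> 'g set" +
  fixes bracket :: "'g \<Rightarrow> 'g \<Rightarrow> 'g"
  assumes bracket_linear_right: "Vector_Spaces.linear scale scale (\<lambda>y. bracket x y)"
    and bracket_linear_left: "Vector_Spaces.linear scale scale (\<lambda>x. bracket x y)"
    and bracket_graded:
      "\<lbrakk>x \<in> part i; y \<in> part j\<rbrakk> \<Longrightarrow> bracket x y \<in> part (i + j)"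
    and super_skew:
      "\<lbrakk>x \<in> part i; y \<in> part j\<rbrakk> \<Longrightarrow> bracket x y = - scale (super_sign i j) (bracket y x)"
    and super_jacobi:
      "\<lbrakk>x \<in> part i; y \<in> part j; w \<in> part k\<rbrakk> \<Longrightarrow>
        bracket x (bracket y w) =
          bracket (bracket x y) w + scale (super_sign i j) (bracket y (bracket x w))"

locale lie_superalgebra_module =
  g: lie_superalgebra gscale gpart bracket + V: super_vector_space vscale vpart
  for gscale :: "complex \<Rightarrow> 'g::ab_group_add \<Rightarrow> 'g" and gpart :: "bit \<Rightarrow> 'g set"
    and bracket :: "'g \<Rightarrow> 'g \<Rightarrow> 'g"
    and vscale :: "complex \<Rightarrow> 'v::ab_group_add \<Rightarrow> 'v" and vpart :: "bit \<Rightarrow> 'v set" +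
  fixes act :: "'g \<Rightarrow> 'v \<Rightarrow> 'v"
  assumes act_linear_right: "Vector_Spaces.linear vscale vscale (\<lambda>v. act x v)"
    and act_linear_left: "Vector_Spaces.linear gscale vscale (\<lambda>x. act x v)"
    and act_graded:
      "\<lbrakk>x \<in> gpart i; v \<in> vpart j\<rbrakk> \<Longrightarrow> act x v \<in> vpart (i + j)"
    and act_bracket:
      "\<lbrakk>x \<in> gpart i; y \<in> gpart j\<rbrakk> \<Longrightarrow>
        act (bracket x y) v = act x (act y v) - vscale (super_sign i j) (act y (act x v))"


section \<open>The Fermion-Virasoro algebra\<close>

text \<open>
  The odd basis vectors are indexed by the coset \<open>\<int> + \<delta>\<close>; \<open>Psi k\<close>, for an integer \<open>k\<close>,
  stands for the basis vector with index \<open>k + \<delta>\<close>. The algebra is the space of finitely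
  supported complex functions on the basis.
\<close>

datatype fv_basis = L int | Psi int | Cgen | Zgen

type_synonym fv = "fv_basis \<Rightarrow>\<^sub>0 complex"

primrec fv_parity :: "fv_basis \<Rightarrow> bit" where
  "fv_parity (L m) = 0"
| "fv_parity (Psi k) = 1"
| "fv_parity Cgen = 0"
| "fv_parity Zgen = 0"

definition fv_scale :: "complex \<Rightarrow> fv \<Rightarrow> fv"
  where "fv_scale c x = Poly_Mapping.map (\<lambda>t. c * t) x"

definition fv_part :: "bit \<Rightarrow> fv set"
  where "fv_part i = {x. \<forall>e\<in>Poly_Mapping.keys x. fv_parity e = i}"

fun fv_bracket_basis :: "real \<Rightarrow> fv_basis \<Rightarrow> fv_basis \<Rightarrow> fv" where
  "fv_bracket_basis \<delta> (L m) (L n) =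
     Poly_Mapping.single (L (m + n)) (of_int (m - n)) +
     (if m = - n then Poly_Mapping.single Cgen ((of_int m ^ 3 - of_int m) / 12) else 0)"
| "fv_bracket_basis \<delta> (L m) (Psi k) =
     Poly_Mapping.single (Psi (m + k)) (- of_real (of_int k + \<delta>) - of_int m / 2)"
| "fv_bracket_basis \<delta> (Psi k) (L m) =
     - Poly_Mapping.single (Psi (m + k)) (- of_real (of_int k + \<delta>) - of_int m / 2)"
| "fv_bracket_basis \<delta> (Psi j) (Psi k) =
     (if of_int j + \<delta> = - (of_int k + \<delta>) then Poly_Mapping.single Zgen 1 else 0)"
| "fv_bracket_basis \<delta> Cgen y = 0"
| "fv_bracket_basis \<delta> Zgen y = 0"
| "fv_bracket_basis \<delta> x Cgen = 0"
| "fv_bracket_basis \<delta> x Zgen = 0"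

definition fv_bracket :: "real \<Rightarrow> fv \<Rightarrow> fv \<Rightarrow> fv" where
  "fv_bracket \<delta> x y =
     (\<Sum>d\<in>Poly_Mapping.keys x. \<Sum>e\<in>Poly_Mapping.keys y.
        fv_scale (Poly_Mapping.lookup x d * Poly_Mapping.lookup y e) (fv_bracket_basis \<delta> d e))"


section \<open>The modules\<close>

text \<open>
  The underlying space is always a direct sum of two polynomial rings in one variable, whose
  first summand is the even part and whose second summand is the odd part.
\<close>

type_synonym poly2 = "complex poly \<times> complex poly"

definition poly2_scale :: "complex \<Rightarrow> poly2 \<Rightarrow> poly2"
  where "poly2_scale c v = (smult c (fst v), smult c (snd v))"

definition poly2_part :: "bit \<Rightarrow> poly2 set"
  where "poly2_part i = (if i = 0 then {(f, 0) | f. True} else {(0, g) | g. True})"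

text \<open>
  \<open>hpow l s r\<close> is the power \<open>l\<^sup>r\<close> for an integer or half-integer \<open>r\<close>, where \<open>s\<close> is the chosen
  square root of \<open>l\<close>. It is used only for \<open>r\<close> in \<open>\<int>\<close> or \<open>\<int> + 1/2\<close>.
\<close>

definition hpow :: "complex \<Rightarrow> complex \<Rightarrow> real \<Rightarrow> complex"
  where "hpow l s r = (if r \<in> \<int> then l powi \<lfloor>r\<rfloor> else l powi \<lfloor>r - 1/2\<rfloor> * s)"

definition shift :: "complex \<Rightarrow> complex poly \<Rightarrow> complex poly"
  where "shift t f = pcompose f [:t, 1:]"

fun Omega_basis ::
  "real \<Rightarrow> complex \<Rightarrow> complex \<Rightarrow> complex \<Rightarrow> complex \<Rightarrow> fv_basis \<Rightarrow> poly2 \<Rightarrow> poly2" where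
  "Omega_basis \<delta> l s a b (L m) (f, g) =
     (smult (l powi m) ([:of_int m * a, 1:] * shift (of_int m) f),
      smult (l powi m) ([:- of_int m / 2 + of_int m * a, 1:] * shift (of_int m) g))"
| "Omega_basis \<delta> l s a b (Psi k) (f, g) =
     (let r = of_int k + \<delta> in (0, smult (b * hpow l s r) (shift (of_real r) f)))"
| "Omega_basis \<delta> l s a b Cgen (f, g) = 0"
| "Omega_basis \<delta> l s a b Zgen (f, g) = 0"

fun Omega'_basis ::
  "real \<Rightarrow> complex \<Rightarrow> complex \<Rightarrow> complex \<Rightarrow> complex \<Rightarrow> fv_basis \<Rightarrow> poly2 \<Rightarrow> poly2" where
  "Omega'_basis \<delta> l s a b (L m) (f, g) =
     (smult (l powi m) ([:of_int m * a, 1:] * shift (of_int m) f),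
      smult (l powi m) ([:- 3 * of_int m / 2 + of_int m * a, 1:] * shift (of_int m) g))"
| "Omega'_basis \<delta> l s a b (Psi k) (f, g) =
     (let r = of_int k + \<delta> in
       (0, smult (b * hpow l s r)
             ([:- 2 * of_real r * a + 3 * of_real r, 1:] * shift (of_real r) f)))"
| "Omega'_basis \<delta> l s a b Cgen (f, g) = 0"
| "Omega'_basis \<delta> l s a b Zgen (f, g) = 0"

fun Omega''_basis ::
  "real \<Rightarrow> complex \<Rightarrow> complex \<Rightarrow> complex \<Rightarrow> fv_basis \<Rightarrow> poly2 \<Rightarrow> poly2" where
  "Omega''_basis \<delta> l s b (L m) (f, g) =
     (smult (l powi m) ([:of_int m, 1:] * shift (of_int m) f),
      smult (l powi m) ([:- 3 / 2 * of_int m, 1:] * shift (of_int m) g))"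
| "Omega''_basis \<delta> l s b (Psi k) (f, g) =
     (let r = of_int k + \<delta> in
       (0, smult (b * hpow l s r)
             ([:3 * of_real r, 1:] * [:of_real r, 1:] * shift (of_real r) f)))"
| "Omega''_basis \<delta> l s b Cgen (f, g) = 0"
| "Omega''_basis \<delta> l s b Zgen (f, g) = 0"

fun Omega''_tilde_basis ::
  "real \<Rightarrow> complex \<Rightarrow> complex \<Rightarrow> complex \<Rightarrow> fv_basis \<Rightarrow> poly2 \<Rightarrow> poly2" where
  "Omega''_tilde_basis \<delta> l s b (L m) (f, g) =
     (smult (l powi m) ([:5 / 2 * of_int m, 1:] * shift (of_int m) f),
      smult (l powi m) ([:0, 1:] * shift (of_int m) g))"
| "Omega''_tilde_basis \<delta> l s b (Psi k) (f, g) =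
     (let r = of_int k + \<delta> in
       (0, smult (b * hpow l s r)
             ([:0, 1:] * [:- 2 * of_real r, 1:] * shift (of_real r) f)))"
| "Omega''_tilde_basis \<delta> l s b Cgen (f, g) = 0"
| "Omega''_tilde_basis \<delta> l s b Zgen (f, g) = 0"

definition fv_extend :: "(fv_basis \<Rightarrow> poly2 \<Rightarrow> poly2) \<Rightarrow> fv \<Rightarrow> poly2 \<Rightarrow> poly2" where
  "fv_extend F x v =
     (\<Sum>e\<in>Poly_Mapping.keys x. poly2_scale (Poly_Mapping.lookup x e) (F e v))"

text \<open>
  \<open>fv_module \<delta> F\<close>: the assignment \<open>F\<close> of operators to the basis vectors, extended linearly,
  makes the direct sum of polynomial rings a graded module.
\<close>

definition fv_module :: "real \<Rightarrow> (fv_basis \<Rightarrow> poly2 \<Rightarrow> poly2) \<Rightarrow> bool" where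
  "fv_module \<delta> F \<longleftrightarrow>
     lie_superalgebra_module fv_scale fv_part (fv_bracket \<delta>)
       poly2_scale poly2_part (fv_extend F)"

end

(* The bracket and the actions are (bi)linear extensions from the basis, so every axiom is a
   statement about basis vectors. All four modules have one shape: with weights alpha on the even
   part, beta on the odd part and polynomials q_r, L_m acts by lambda^m (x + m alpha) f(x + m) and
   lambda^m (x + m beta) g(x + m), and psi_r by b lambda^r q_r(x) f(x + r). The [L_m, L_n] relations
   then always hold, products of two odd operators vanish, and [L_m, psi_r] reduces to
   (x + m beta) q_r(x + m) - (x + r + m alpha) q_r(x) = (-r - m/2) q_(r+m)(x). *)
theory Submission
  imports Defs
begin

section \<open>The Fermion-Virasoro algebra as a Lie superalgebra\<close>

lemma lookup_fv_scale: "Poly_Mapping.lookup (fv_scale c x) e = c * Poly_Mapping.lookup x e"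
  by (simp add: fv_scale_def Poly_Mapping.map.rep_eq when_def)

lemma fv_scale_single [simp]:
  "fv_scale c (Poly_Mapping.single e t) = Poly_Mapping.single e (c * t)"
  by (rule poly_mapping_eqI) (simp add: lookup_fv_scale lookup_single when_def)

interpretation fv: vector_space fv_scale
  by unfold_locales
    (auto intro!: poly_mapping_eqI simp: lookup_fv_scale lookup_add algebra_simps)

lemma fv_part_iff: "x \<in> fv_part i \<longleftrightarrow> (\<forall>e. Poly_Mapping.lookup x e \<noteq> 0 \<longrightarrow> fv_parity e = i)"
  by (auto simp: fv_part_def in_keys_iff)

lemma subspace_fv_part: "fv.subspace (fv_part i)"
  by (auto simp: fv.subspace_def fv_part_iff lookup_add lookup_fv_scale)
    (metis add.right_neutral)

lemma zero_in_fv_part [simp]: "0 \<in> fv_part i"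
  by (simp add: fv_part_iff)

lemma single_in_fv_part [simp]: "fv_parity e = i \<Longrightarrow> Poly_Mapping.single e c \<in> fv_part i"
  by (simp add: fv_part_def)

lemma sum_single_lookup:
  "(\<Sum>e\<in>Poly_Mapping.keys x. Poly_Mapping.single e (Poly_Mapping.lookup x e)) = x"
  by (rule poly_mapping_eqI)
    (simp add: lookup_sum lookup_single when_def sum.delta in_keys_iff)

text \<open>Reduces a graded multilinear axiom to homogeneous basis vectors, one argument at a time:
  an element of parity \<open>i\<close> is a combination of basis vectors in its support, all of
  parity \<open>i\<close>.\<close>

lemma fv_part_induct [consumes 1, case_names zero add scale basis]:
  assumes "x \<in> fv_part i"
    and "P 0"
    and add: "\<And>x y. P x \<Longrightarrow> P y \<Longrightarrow> P (x + y)"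
    and scale: "\<And>c x. P x \<Longrightarrow> P (fv_scale c x)"
    and basis: "\<And>e. fv_parity e = i \<Longrightarrow> P (Poly_Mapping.single e 1)"
  shows "P x"
proof -
  have "P (\<Sum>e\<in>A. Poly_Mapping.single e (Poly_Mapping.lookup x e))"
    if "finite A" "A \<subseteq> Poly_Mapping.keys x" for A
    using that
  proof (induction A rule: finite_induct)
    case (insert e A)
    then have "P (fv_scale (Poly_Mapping.lookup x e) (Poly_Mapping.single e 1))"
      using assms(1) by (intro scale basis) (auto simp: fv_part_def)
    with insert show ?case
      by (auto intro: add)
  qed (simp add: \<open>P 0\<close>)
  from this[of "Poly_Mapping.keys x"] show ?thesis
    by (simp add: sum_single_lookup)
qed

section \<open>Linear extension from the basis\<close>

context vector_space
begin

text \<open>Supports may shrink under cancellation or scaling by 0. Summing over a fixed larger set,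
  where the extra coefficients are 0, makes such sums comparable.\<close>

lemma sum_keys_superset:
  assumes "finite A" "Poly_Mapping.keys x \<subseteq> A"
  shows "(\<Sum>e\<in>Poly_Mapping.keys x. scale (Poly_Mapping.lookup x e) (h e)) =
         (\<Sum>e\<in>A. scale (Poly_Mapping.lookup x e) (h e))"
  using assms by (intro sum.mono_neutral_left) (auto simp: in_keys_iff)

lemma sum_keys_add:
  "(\<Sum>e\<in>Poly_Mapping.keys (x + y). scale (Poly_Mapping.lookup (x + y) e) (h e)) =
   (\<Sum>e\<in>Poly_Mapping.keys x. scale (Poly_Mapping.lookup x e) (h e)) +
   (\<Sum>e\<in>Poly_Mapping.keys y. scale (Poly_Mapping.lookup y e) (h e))"
proof -
  let ?A = "Poly_Mapping.keys x \<union> Poly_Mapping.keys y"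
  have "Poly_Mapping.keys (x + y) \<subseteq> ?A"
    by (rule Poly_Mapping.keys_add)
  then show ?thesis
    by (simp only: sum_keys_superset[of ?A "x + y"] sum_keys_superset[of ?A x]
        sum_keys_superset[of ?A y] finite_Un finite_keys Un_upper1 Un_upper2)
      (simp add: lookup_add scale_left_distrib sum.distrib)
qed

end

lemma sum_keys_scale:
  fixes scale :: "complex \<Rightarrow> 'b::ab_group_add \<Rightarrow> 'b"
  assumes "vector_space scale"
  shows "(\<Sum>e\<in>Poly_Mapping.keys (fv_scale c x).
           scale (Poly_Mapping.lookup (fv_scale c x) e) (h e)) =
         scale c (\<Sum>e\<in>Poly_Mapping.keys x. scale (Poly_Mapping.lookup x e) (h e))"
proof -
  interpret vector_space scale by fact
  have "Poly_Mapping.keys (fv_scale c x) \<subseteq> Poly_Mapping.keys x"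
    by (auto simp: in_keys_iff lookup_fv_scale)
  then show ?thesis
    by (simp only: sum_keys_superset[of "Poly_Mapping.keys x" "fv_scale c x"] finite_keys)
      (simp add: lookup_fv_scale scale_sum_right)
qed

text \<open>With the sum over one argument outermost, linearity in that argument follows from the
  lemmas on sums over keys; the next lemma does the same for the other argument.\<close>

lemma fv_bracket_eq_left:
  "fv_bracket \<delta> x y = (\<Sum>d\<in>Poly_Mapping.keys x. fv_scale (Poly_Mapping.lookup x d)
     (\<Sum>e\<in>Poly_Mapping.keys y. fv_scale (Poly_Mapping.lookup y e) (fv_bracket_basis \<delta> d e)))"
  by (simp add: fv_bracket_def fv.scale_sum_right)

lemma fv_bracket_eq_right:
  "fv_bracket \<delta> x y = (\<Sum>e\<in>Poly_Mapping.keys y. fv_scale (Poly_Mapping.lookup y e)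
     (\<Sum>d\<in>Poly_Mapping.keys x. fv_scale (Poly_Mapping.lookup x d) (fv_bracket_basis \<delta> d e)))"
  unfolding fv_bracket_def by (subst sum.swap) (simp add: fv.scale_sum_right mult.commute)

lemma linear_fv_bracket_left: "Vector_Spaces.linear fv_scale fv_scale (\<lambda>x. fv_bracket \<delta> x y)"
  unfolding Vector_Spaces.linear_iff fv_bracket_eq_left
  by (simp add: fv.sum_keys_add sum_keys_scale[OF fv.vector_space_axioms] fv.vector_space_axioms)

lemma linear_fv_bracket_right: "Vector_Spaces.linear fv_scale fv_scale (fv_bracket \<delta> x)"
  unfolding Vector_Spaces.linear_iff fv_bracket_eq_right
  by (simp add: fv.sum_keys_add sum_keys_scale[OF fv.vector_space_axioms] fv.vector_space_axioms)

interpretation fv_bracket_left: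
  Vector_Spaces.linear fv_scale fv_scale "\<lambda>x. fv_bracket \<delta> x y" for \<delta> y
  by (rule linear_fv_bracket_left)

interpretation fv_bracket_right: Vector_Spaces.linear fv_scale fv_scale "fv_bracket \<delta> x" for \<delta> x
  by (rule linear_fv_bracket_right)

lemmas fv_bracket_linear [simp] =
  fv_bracket_left.zero fv_bracket_left.add fv_bracket_left.scale fv_bracket_left.neg
  fv_bracket_right.zero fv_bracket_right.add fv_bracket_right.scale fv_bracket_right.neg

section \<open>The superalgebra axioms, first on basis vectors\<close>

lemma fv_bracket_single [simp]:
  "fv_bracket \<delta> (Poly_Mapping.single d s) (Poly_Mapping.single e t) =
     fv_scale (s * t) (fv_bracket_basis \<delta> d e)"
  by (simp add: fv_bracket_def)

lemma fv_bracket_basis_graded: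
  "fv_bracket_basis \<delta> d e \<in> fv_part (fv_parity d + fv_parity e)"
  by (cases d; cases e)
    (auto intro!: fv.subspace_add subspace_fv_part fv.subspace_neg)

lemma fv_bracket_basis_skew:
  "fv_bracket_basis \<delta> d e =
     - fv_scale (super_sign (fv_parity d) (fv_parity e)) (fv_bracket_basis \<delta> e d)"
  by (cases d; cases e)
    (auto simp: super_sign_def add.commute simp flip: single_uminus single_add single_diff,
     simp_all add: diff_divide_distrib)

text \<open>In the Jacobi identity for one L_m and two odd vectors, a z-term occurs only if m and
  the two odd indices sum to 0. Solving this for \<delta> lets it be substituted into the complex
  coefficients.\<close>

lemma of_real_half_index:
  assumes "2 * \<delta> + real_of_int j = - real_of_int m - real_of_int k"
  shows "complex_of_real \<delta> = - (of_int j + of_int m + of_int k) / 2"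
proof -
  have "\<delta> = - (real_of_int j + real_of_int m + real_of_int k) / 2"
    using assms by simp
  then show ?thesis
    by (simp only:) simp
qed

text \<open>Three kinds of triples have content. Three L's need the cocycle identity for m^3 - m.
  Two L's and a psi need the coefficients -n - m/2 to represent the Witt relations. For L_m, psi_r,
  psi_s the z-coefficients add up to -(r + s + m), which is 0 whenever z occurs.\<close>

lemma fv_bracket_basis_jacobi:
  fixes d e f :: fv_basis
  defines "x \<equiv> Poly_Mapping.single d 1" and "y \<equiv> Poly_Mapping.single e 1"
    and "w \<equiv> Poly_Mapping.single f 1"
  shows "fv_bracket \<delta> x (fv_bracket \<delta> y w) =
     fv_bracket \<delta> (fv_bracket \<delta> x y) w +
     fv_scale (super_sign (fv_parity d) (fv_parity e)) (fv_bracket \<delta> y (fv_bracket \<delta> x w))"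
  unfolding assms
  by (cases d; cases e; cases f;
      simp add: super_sign_def if_distrib[of "fv_bracket _ _"]
        if_distrib[of "\<lambda>x. fv_bracket _ x _"] cong: if_cong)
    (auto intro!: poly_mapping_eqI dest!: of_real_half_index
       simp: lookup_add lookup_minus lookup_fv_scale lookup_single when_def
         add.assoc add.left_commute,
     auto simp: field_simps power3_eq_cube,
     simp_all add: complex_eq_iff)

lemma lie_superalgebra_fv: "lie_superalgebra fv_scale fv_part (fv_bracket \<delta>)"
proof unfold_locales
  show "fv.subspace (fv_part i)" for i
    by (rule subspace_fv_part)
  show "fv_part 0 \<inter> fv_part 1 = {0}"
    by (auto simp: fv_part_iff intro!: poly_mapping_eqI)
  show "\<exists>x\<in>fv_part 0. \<exists>y\<in>fv_part 1. v = x + y" for v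
  proof -
    define c where
      "c i = (\<Sum>e\<in>{e \<in> Poly_Mapping.keys v. fv_parity e = i}.
         Poly_Mapping.single e (Poly_Mapping.lookup v e))" for i
    have "c i \<in> fv_part i" for i
      unfolding c_def by (intro fv.subspace_sum[OF subspace_fv_part]) simp
    moreover have "v = c 0 + c 1"
    proof -
      have "Poly_Mapping.keys v = {e \<in> Poly_Mapping.keys v. fv_parity e = 0} \<union>
        {e \<in> Poly_Mapping.keys v. fv_parity e = 1}"
        by auto
      then have "c 0 + c 1 =
        (\<Sum>e\<in>Poly_Mapping.keys v. Poly_Mapping.single e (Poly_Mapping.lookup v e))"
        unfolding c_def by (subst sum.union_disjoint[symmetric]) (auto intro: sum.cong)
      then show ?thesis
        by (simp add: sum_single_lookup)
    qed
    ultimately show ?thesis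
      by blast
  qed
  fix i j k x y w
  assume x: "x \<in> fv_part i" and y: "y \<in> fv_part j"
  show "fv_bracket \<delta> x y \<in> fv_part (i + j)"
    using x
  proof (induction rule: fv_part_induct)
    case (basis d)
    from y show ?case
      by (induction rule: fv_part_induct)
        (auto intro: subspace_fv_part fv.subspace_add fv.subspace_scale
           simp: fv_bracket_basis_graded simp flip: basis simp del: add_bit_eq_xor)
  qed (auto intro: subspace_fv_part fv.subspace_add fv.subspace_scale)
  show "fv_bracket \<delta> x y = - fv_scale (super_sign i j) (fv_bracket \<delta> y x)"
    using x
  proof (induction rule: fv_part_induct)
    case (basis d)
    from y show ?case
    proof (induction rule: fv_part_induct)
      case (basis e)
      then show ?case
        using fv_bracket_basis_skew[of \<delta> d e] \<open>fv_parity d = i\<close> by simp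
    qed (auto simp: fv.scale_right_distrib mult.commute)
  qed (auto simp: fv.scale_right_distrib mult.commute)
  assume w: "w \<in> fv_part k"
  show "fv_bracket \<delta> x (fv_bracket \<delta> y w) =
     fv_bracket \<delta> (fv_bracket \<delta> x y) w +
     fv_scale (super_sign i j) (fv_bracket \<delta> y (fv_bracket \<delta> x w))"
    \<comment> \<open>Both sides are linear in each of x, y, w, so three nested inductions reach the
      basis case.\<close>
    using x
  proof (induction rule: fv_part_induct)
    case d: (basis d)
    from y show ?case
    proof (induction rule: fv_part_induct)
      case e: (basis e)
      from w show ?case
      proof (induction rule: fv_part_induct)
        case (basis f)
        show ?case
          using fv_bracket_basis_jacobi[of \<delta> d e f] d e by simp
      qed (auto simp: fv.scale_right_distrib mult.commute algebra_simps)
    qed (auto simp: fv.scale_right_distrib mult.commute algebra_simps)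
  qed (auto simp: fv.scale_right_distrib mult.commute algebra_simps)
qed


section \<open>Modules on pairs of polynomials\<close>

interpretation poly2: vector_space poly2_scale
  by unfold_locales (auto simp: poly2_scale_def smult_add_right smult_add_left)

lemma poly2_scale_Pair [simp]: "poly2_scale c (f, g) = (smult c f, smult c g)"
  by (simp add: poly2_scale_def)

lemma subspace_poly2_part: "poly2.subspace (poly2_part i)"
  by (auto simp: poly2.subspace_def poly2_part_def zero_prod_def)

lemma super_vector_space_poly2: "super_vector_space poly2_scale poly2_part"
proof unfold_locales
  show "\<exists>x\<in>poly2_part 0. \<exists>y\<in>poly2_part 1. v = x + y" for v
    by (rule bexI[of _ "(fst v, 0)"], rule bexI[of _ "(0, snd v)"]) (auto simp: poly2_part_def)
qed (auto simp: subspace_poly2_part, auto simp: poly2_part_def zero_prod_def)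

lemma linear_fv_extend_left:
  "Vector_Spaces.linear fv_scale poly2_scale (\<lambda>x. fv_extend F x v)"
  unfolding Vector_Spaces.linear_iff fv_extend_def
  by (simp add: poly2.sum_keys_add sum_keys_scale[OF poly2.vector_space_axioms]
      fv.vector_space_axioms poly2.vector_space_axioms)

interpretation fv_extend_left: Vector_Spaces.linear fv_scale poly2_scale "\<lambda>x. fv_extend F x v" for F v
  by (rule linear_fv_extend_left)

lemma fv_extend_single [simp]:
  "fv_extend F (Poly_Mapping.single e c) v = poly2_scale c (F e v)"
  by (simp add: fv_extend_def)

text \<open>\<open>fv_extend\<close> is linear in the algebra element for any \<open>F\<close>, and
  \<open>linear\<close> gives linearity in the vector. The module law is therefore bilinear in the
  two algebra elements and follows from pairs of basis vectors.\<close>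

lemma fv_moduleI:
  assumes linear: "\<And>e. Vector_Spaces.linear poly2_scale poly2_scale (F e)"
    and graded: "\<And>e j v. v \<in> poly2_part j \<Longrightarrow> F e v \<in> poly2_part (fv_parity e + j)"
    and bracket: "\<And>d e v. fv_extend F (fv_bracket_basis \<delta> d e) v =
      F d (F e v) - poly2_scale (super_sign (fv_parity d) (fv_parity e)) (F e (F d v))"
  shows "fv_module \<delta> F"
proof -
  interpret lie_superalgebra fv_scale fv_part "fv_bracket \<delta>"
    by (rule lie_superalgebra_fv)
  interpret V: super_vector_space poly2_scale poly2_part
    by (rule super_vector_space_poly2)
  have linear_right: "Vector_Spaces.linear poly2_scale poly2_scale (fv_extend F x)" for x
    using linear unfolding Vector_Spaces.linear_iff fv_extend_def
    by (simp add: poly2.scale_right_distrib sum.distrib poly2.scale_sum_right mult.commute)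
  interpret right: Vector_Spaces.linear poly2_scale poly2_scale "fv_extend F x" for x
    by (rule linear_right)
  interpret F: Vector_Spaces.linear poly2_scale poly2_scale "F e" for e
    by (rule linear)
  note linear_simps = F.add F.scale F.zero right.add right.scale right.zero fv_extend_left.zero
    fv_extend_left.add fv_extend_left.scale
  show ?thesis
    unfolding fv_module_def
  proof unfold_locales
    fix i j x y v
    assume x: "x \<in> fv_part i"
    show "fv_extend F x v \<in> poly2_part (i + j)" if v: "v \<in> poly2_part j"
      using x
      by (induction rule: fv_part_induct)
        (auto intro: subspace_poly2_part poly2.subspace_0 poly2.subspace_add poly2.subspace_scale
           graded v simp: linear_simps simp del: add_bit_eq_xor)
    assume y: "y \<in> fv_part j"
    show "fv_extend F (fv_bracket \<delta> x y) v = fv_extend F x (fv_extend F y v) -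
        poly2_scale (super_sign i j) (fv_extend F y (fv_extend F x v))"
      using x
    proof (induction rule: fv_part_induct)
      case d: (basis d)
      from y show ?case
      proof (induction rule: fv_part_induct)
        case (basis e)
        then show ?case
          using bracket[of d e v] d by simp
      qed (simp_all add: linear_simps poly2.scale_right_distrib poly2.scale_right_diff_distrib
          mult.commute)
    qed (simp_all add: linear_simps poly2.scale_right_distrib poly2.scale_right_diff_distrib
          mult.commute)
  qed
qed

section \<open>Shift operators and the L_m-action\<close>

lemma poly_ext: "(\<And>x. poly p x = poly q x) \<Longrightarrow> p = q" for p q :: "complex poly"
  by (simp add: fun_eq_iff flip: poly_eq_poly_eq_iff)

lemma poly_shift [simp]: "poly (shift t f) x = poly f (t + x)"
  by (simp add: shift_def poly_pcompose)

lemma shift_add: "shift t (f + g) = shift t f + shift t g"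
  by (simp add: shift_def pcompose_add)

lemma shift_smult: "shift t (smult c f) = smult c (shift t f)"
  by (simp add: shift_def pcompose_smult)

lemma shift_0 [simp]: "shift t 0 = 0"
  by (simp add: shift_def)

text \<open>This is the action of L_m on a Witt module free of rank one over polynomials in L_0,
  which acts as multiplication by x.\<close>

definition weight_act :: "complex \<Rightarrow> complex \<Rightarrow> int \<Rightarrow> complex poly \<Rightarrow> complex poly"
  where "weight_act l \<alpha> m f = smult (l powi m) ([:of_int m * \<alpha>, 1:] * shift (of_int m) f)"

lemma weight_act_linear:
  "weight_act l \<alpha> m (f + g) = weight_act l \<alpha> m f + weight_act l \<alpha> m g"
  "weight_act l \<alpha> m (smult c f) = smult c (weight_act l \<alpha> m f)"
  "weight_act l \<alpha> m 0 = 0"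
  by (simp_all add: weight_act_def shift_add shift_smult algebra_simps smult_add_right)

text \<open>Both composites carry the factor l^(m+n) f(x + m + n), and (x + m\<alpha>)(x + m +
  n\<alpha>) - (x + n\<alpha>)(x + n + m\<alpha>) = (m - n)(x + (m + n)\<alpha>).\<close>

lemma weight_act_commutator:
  assumes "l \<noteq> 0"
  shows "weight_act l \<alpha> m (weight_act l \<alpha> n f) - weight_act l \<alpha> n (weight_act l \<alpha> m f) =
    smult (of_int (m - n)) (weight_act l \<alpha> (m + n) f)"
  using assms by (intro poly_ext) (simp add: weight_act_def power_int_add algebra_simps)

text \<open>An integer shift preserves the coset of the exponent, so the factor \<open>s\<close> is
  present on both sides or on neither.\<close>

lemma hpow_add:
  assumes "\<delta> \<in> {0, 1/2}" "l \<noteq> 0"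
  shows "hpow l s (of_int (m + k) + \<delta>) = l powi m * hpow l s (of_int k + \<delta>)"
proof (cases "\<delta> = 0")
  case True
  then show ?thesis
    using assms by (simp add: hpow_def power_int_add flip: of_int_add)
next
  case False
  with assms have \<delta>: "\<delta> = 1/2"
    by simp
  \<comment> \<open>Rules out the integer branch of \<open>hpow\<close>; in the other branch the
    floor is exactly \<open>j\<close>.\<close>
  have "of_int j + 1/2 \<notin> (\<int> :: real set)" for j
  proof
    assume "of_int j + 1/2 \<in> (\<int> :: real set)"
    then obtain n where "of_int j + 1/2 = (of_int n :: real)"
      by (rule Ints_cases)
    then have "of_int (2 * j + 1) = (of_int (2 * n) :: real)"
      by simp
    then have "2 * j + 1 = 2 * n"
      by (simp only: of_int_eq_iff)
    then show False
      by presburger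
  qed
  then have "hpow l s (of_int j + \<delta>) = l powi j * s" for j
    by (simp add: hpow_def \<delta>)
  with assms show ?thesis
    by (simp only:) (simp add: power_int_add)
qed

text \<open>\<open>q\<close> takes a complex index, so that the compatibility condition can be
  checked as a polynomial identity in m, r and x.\<close>

lemma fv_module_shiftI:
  fixes q :: "complex \<Rightarrow> complex poly"
  assumes "\<delta> \<in> {0, 1/2}" "l \<noteq> 0"
    and F_L: "\<And>m f g. F (L m) (f, g) = (weight_act l \<alpha> m f, weight_act l \<beta> m g)"
    and F_Psi: "\<And>k f g. F (Psi k) (f, g) =
      (0, smult (b * hpow l s (of_int k + \<delta>))
        (q (of_int k + of_real \<delta>) * shift (of_int k + of_real \<delta>) f))"
    and F_central: "\<And>v. F Cgen v = 0" "\<And>v. F Zgen v = 0"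
    and q: "\<And>m r x. (x + m * \<beta>) * poly (q r) (x + m) - (x + r + m * \<alpha>) * poly (q r) x =
      (- r - m / 2) * poly (q (r + m)) x"
  shows "fv_module \<delta> F"
proof (rule fv_moduleI)
  \<comment> \<open>Odd operators ignore the odd component of their argument, so g' and g'' are
    arbitrary.\<close>
  have L_Psi: "weight_act l \<beta> m (snd (F (Psi k) (f, g))) -
      snd (F (Psi k) (weight_act l \<alpha> m f, g')) =
      smult (- (of_int k + of_real \<delta>) - of_int m / 2) (snd (F (Psi (m + k)) (f, g'')))"
    (is "?lhs = ?rhs") for m k f g g' g''
  proof (rule poly_ext)
    fix x
    define r where "r = of_int k + complex_of_real \<delta>"
    \<comment> \<open>The factor common to both orders of applying L_m and psi_r; by
      \<open>hpow_add\<close> it is also the one in the action of psi_(r+m).\<close>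
    define h where "h = b * l powi m * hpow l s (of_int k + \<delta>) * poly f (x + of_int m + r)"
    have "poly ?lhs x = h * ((x + of_int m * \<beta>) * poly (q r) (x + of_int m) -
        (x + r + of_int m * \<alpha>) * poly (q r) x)"
      by (simp add: F_Psi weight_act_def h_def r_def algebra_simps)
    also have "\<dots> = h * ((- r - of_int m / 2) * poly (q (r + of_int m)) x)"
      by (simp only: q)
    also have "\<dots> = poly ?rhs x"
      using hpow_add[OF assms(1,2), of s m k] by (simp add: F_Psi h_def r_def add_ac mult_ac)
    finally show "poly ?lhs x = poly ?rhs x" .
  qed
  then have Psi_L: "snd (F (Psi k) (weight_act l \<alpha> m f, g')) -
      weight_act l \<beta> m (snd (F (Psi k) (f, g))) =
      - smult (- (of_int k + of_real \<delta>) - of_int m / 2) (snd (F (Psi (m + k)) (f, g'')))"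
    for m k f g g' g''
    by (metis minus_diff_eq)
  \<comment> \<open>In relations with a central element, the other operator is applied to 0.\<close>
  have F_zero: "F e 0 = 0" for e
    by (cases e) (simp_all add: zero_prod_def F_L F_Psi F_central weight_act_linear)
  show "Vector_Spaces.linear poly2_scale poly2_scale (F e)" for e
    unfolding Vector_Spaces.linear_iff
    by (cases e) (auto simp: poly2.vector_space_axioms F_L F_Psi F_central weight_act_linear
        shift_add shift_smult smult_add_right distrib_left mult_ac)
  show "F e v \<in> poly2_part (fv_parity e + j)" if "v \<in> poly2_part j" for e j v
    using that by (cases e; cases j)
      (auto simp: poly2_part_def F_L F_Psi F_central weight_act_linear zero_prod_def)
  fix d e and v :: poly2
  obtain f g where v: "v = (f, g)"
    by (cases v)
  show "fv_extend F (fv_bracket_basis \<delta> d e) v =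
      F d (F e v) - poly2_scale (super_sign (fv_parity d) (fv_parity e)) (F e (F d v))"
    using weight_act_commutator[OF assms(2)] L_Psi Psi_L
    by (cases d; cases e)
      (auto simp: super_sign_def v F_L F_Psi F_central F_zero fv_extend_left.add
        fv_extend_left.neg fv_extend_left.zero zero_prod_def weight_act_linear)
qed

theorem lemma6p2:
  fixes \<delta> :: real and lam sqrt_lam a b :: complex
  assumes "\<delta> \<in> {0, 1/2}"
    and "lam \<noteq> 0" and "sqrt_lam\<^sup>2 = lam"
  shows "fv_module \<delta> (Omega_basis \<delta> lam sqrt_lam a b)
       \<and> fv_module \<delta> (Omega'_basis \<delta> lam sqrt_lam a b)
       \<and> fv_module \<delta> (Omega''_basis \<delta> lam sqrt_lam b)
       \<and> fv_module \<delta> (Omega''_tilde_basis \<delta> lam sqrt_lam b)"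
proof (intro conjI)
  note shiftI = fv_module_shiftI[OF assms(1,2), where b = b and s = sqrt_lam]
  have central: "F e v = 0" if "\<And>f g. F e (f, g) = 0" for F and e :: fv_basis and v :: poly2
    using that by (cases v) simp
  \<comment> \<open>In all four cases q_r is monic in x, of degree d = 0, 1, 2, 2. Comparing
    coefficients of x^d in the condition on q forces \<alpha> - \<beta> = d + 1/2, which the chosen
    weights satisfy.\<close>
  show "fv_module \<delta> (Omega_basis \<delta> lam sqrt_lam a b)"
    by (rule shiftI[where \<alpha> = a and \<beta> = "a - 1/2" and q = "\<lambda>r. 1"])
      (auto simp: weight_act_def Let_def algebra_simps intro: central)
  show "fv_module \<delta> (Omega'_basis \<delta> lam sqrt_lam a b)"
    by (rule shiftI[where \<alpha> = a and \<beta> = "a - 3/2" and q = "\<lambda>r. [:- 2 * r * a + 3 * r, 1:]"])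
      (auto simp: weight_act_def Let_def algebra_simps intro: central)
  show "fv_module \<delta> (Omega''_basis \<delta> lam sqrt_lam b)"
    by (rule shiftI[where \<alpha> = 1 and \<beta> = "- 3/2" and q = "\<lambda>r. [:3 * r, 1:] * [:r, 1:]"])
      (auto simp: weight_act_def Let_def algebra_simps intro: central)
  show "fv_module \<delta> (Omega''_tilde_basis \<delta> lam sqrt_lam b)"
    by (rule shiftI[where \<alpha> = "5/2" and \<beta> = 0 and q = "\<lambda>r. [:0, 1:] * [:- 2 * r, 1:]"])
      (auto simp: weight_act_def Let_def algebra_simps smult_add_left
        smult_diff_left intro: central)
qed

end
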